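(* If $n\geq 2$ and $k\geq 1$, then the sphere $\mathbb{S}^{2k}$ has the fixed point property for $n$-valued maps; that is, every $n$-valued map $\phi\colon \mathbb{S}^{2k}\multimap\mathbb{S}^{2k}$ has a fixed point.
   Context: A multifunction $\phi\colon X\multimap Y$ between topological spaces assigns to each $x\in X$ a non-empty subset $\phi(x)\subset Y$. It is upper semi-continuous if $\phi(x)$ is closed for all $x$ and $\{x\in X\mid \phi(x)\subset V\}$ is open in $X$ for every open $V\subset Y$; lower semi-continuous if $\{x\in X\mid \phi(x)\cap V\neq\varnothing\}$ is open in $X$ for every open $V\subset Y$; continuous if it is both. An $n$-valued map $\phi\colon X\multimap Y$ is a continuous multifunction such that $\phi(x)$ has exactly $n$ elements for every $x\in X$. A fixed point of $\phi\colon X\multimap X$ is a point $x\in X$ with $x\in\phi(x)$. *)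

theory Defs
  imports "HOL-Analysis.Analysis"
begin

text \<open>
  A multifunction from \<open>X\<close> to \<open>Y\<close> is encoded as a function into sets; only its values at points of
  the topological space \<open>X\<close> matter.
\<close>

definition multifunction :: "'a topology \<Rightarrow> 'b topology \<Rightarrow> ('a \<Rightarrow> 'b set) \<Rightarrow> bool" where
  "multifunction X Y \<phi> \<longleftrightarrow> (\<forall>x\<in>topspace X. \<phi> x \<noteq> {} \<and> \<phi> x \<subseteq> topspace Y)"

definition upper_semicontinuous :: "'a topology \<Rightarrow> 'b topology \<Rightarrow> ('a \<Rightarrow> 'b set) \<Rightarrow> bool" where
  "upper_semicontinuous X Y \<phi> \<longleftrightarrow>
     multifunction X Y \<phi> \<and>
     (\<forall>x\<in>topspace X. closedin Y (\<phi> x)) \<and>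
     (\<forall>V. openin Y V \<longrightarrow> openin X {x \<in> topspace X. \<phi> x \<subseteq> V})"

definition lower_semicontinuous :: "'a topology \<Rightarrow> 'b topology \<Rightarrow> ('a \<Rightarrow> 'b set) \<Rightarrow> bool" where
  "lower_semicontinuous X Y \<phi> \<longleftrightarrow>
     multifunction X Y \<phi> \<and>
     (\<forall>V. openin Y V \<longrightarrow> openin X {x \<in> topspace X. \<phi> x \<inter> V \<noteq> {}})"

definition continuous_multifunction :: "'a topology \<Rightarrow> 'b topology \<Rightarrow> ('a \<Rightarrow> 'b set) \<Rightarrow> bool" where
  "continuous_multifunction X Y \<phi> \<longleftrightarrow>
     upper_semicontinuous X Y \<phi> \<and> lower_semicontinuous X Y \<phi>"

definition n_valued_map :: "nat \<Rightarrow> 'a topology \<Rightarrow> 'b topology \<Rightarrow> ('a \<Rightarrow> 'b set) \<Rightarrow> bool" where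
  "n_valued_map n X Y \<phi> \<longleftrightarrow>
     continuous_multifunction X Y \<phi> \<and> (\<forall>x\<in>topspace X. finite (\<phi> x) \<and> card (\<phi> x) = n)"

definition multi_fixed_point :: "'a topology \<Rightarrow> ('a \<Rightarrow> 'a set) \<Rightarrow> 'a \<Rightarrow> bool" where
  "multi_fixed_point X \<phi> x \<longleftrightarrow> x \<in> topspace X \<and> x \<in> \<phi> x"

definition n_valued_fixed_point_property :: "nat \<Rightarrow> 'a topology \<Rightarrow> bool" where
  "n_valued_fixed_point_property n X \<longleftrightarrow>
     (\<forall>\<phi>. n_valued_map n X X \<phi> \<longrightarrow> (\<exists>x. multi_fixed_point X \<phi> x))"

end

theory Submission
  imports Defs "HOL-Homology.Brouwer_Degree"
begin

text \<open>
  The sphere \<open>S\<close> has dimension \<open>2 * k\<close> with \<open>k \<ge> 1\<close>, so it is simply connected, and simple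
  connectivity forces an \<open>n\<close>-valued map \<open>\<phi>\<close> on it to split. Indeed the graph
  \<open>{(x, y). y \<in> \<phi> x}\<close> is an \<open>n\<close>-sheeted covering space of \<open>S\<close>
  (\<open>n_valued_map_graph_covering_space\<close>): distinct values of \<open>\<phi>\<close> at a point sit in disjoint open sets,
  lower semicontinuity keeps a value in each of them nearby, and the constant number of values leaves
  no room for a second one. Lifting the identity of \<open>S\<close> through this covering extends every value of
  \<open>\<phi>\<close> at a point to a continuous selection, and by uniqueness of lifts two selections that differ at
  one point differ everywhere. As \<open>n \<ge> 2\<close>, there are two selections \<open>f\<close> and \<open>g\<close> with \<open>f x \<noteq> g x\<close> for
  all \<open>x\<close>.

  Maps into a sphere that are nowhere antipodal to each other are homotopic. If \<open>\<phi>\<close> had no fixed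
  point, then neither would \<open>f\<close> and \<open>g\<close>, and writing \<open>a\<close> for the antipodal map one would get
  \<open>a \<simeq> f\<close> because \<open>f x \<noteq> x\<close>, then \<open>f \<simeq> a \<circ> g\<close> because \<open>f x \<noteq> g x\<close>, and \<open>a \<circ> g \<simeq> id\<close> because
  \<open>g x \<noteq> x\<close>. Hence \<open>a \<simeq> id\<close>. But \<open>a\<close> is a composition of \<open>2 * k + 1\<close> coordinate reflections, each of
  degree \<open>-1\<close>, so its degree is \<open>-1\<close> while that of the identity is \<open>1\<close>
  (\<open>antipodal_not_homotopic_id_even_sphere\<close>).
\<close>

section \<open>Splitting multivalued maps on simply connected spaces\<close>

lemma n_valued_mapD:
  assumes "n_valued_map n (top_of_set S) (top_of_set T) \<phi>" "x \<in> S"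
  shows "\<phi> x \<subseteq> T" "finite (\<phi> x)" "card (\<phi> x) = n"
  using assms by (auto simp: n_valued_map_def continuous_multifunction_def
      lower_semicontinuous_def multifunction_def)

lemma n_valued_map_openin:
  assumes "n_valued_map n (top_of_set S) (top_of_set T) \<phi>" "open V"
  shows "openin (top_of_set S) {x \<in> S. \<phi> x \<inter> V \<noteq> {}}"
proof -
  have "openin (top_of_set S) {x \<in> S. \<phi> x \<inter> (T \<inter> V) \<noteq> {}}"
    using assms(1) openin_open_Int[OF assms(2), of T]
    by (simp add: n_valued_map_def continuous_multifunction_def lower_semicontinuous_def)
  moreover have "{x \<in> S. \<phi> x \<inter> (T \<inter> V) \<noteq> {}} = {x \<in> S. \<phi> x \<inter> V \<noteq> {}}"
  proof -
    have "\<phi> x \<inter> (T \<inter> V) = \<phi> x \<inter> V" if "x \<in> S" for x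
      using n_valued_mapD(1)[OF assms(1) that] by blast
    then show ?thesis by auto
  qed
  ultimately show ?thesis by simp
qed

lemma finite_disjoint_open_neighbourhoods:
  fixes F :: "'a::metric_space set"
  assumes "finite F"
  obtains B where "\<And>y. y \<in> F \<Longrightarrow> open (B y) \<and> y \<in> B y" "disjoint_family_on B F"
proof -
  have "\<forall>y\<in>F. \<exists>d>0. \<forall>z\<in>F. z \<noteq> y \<longrightarrow> d \<le> dist y z"
    using finite_set_avoid[OF assms] by metis
  then obtain d where d: "\<And>y. y \<in> F \<Longrightarrow> d y > 0"
      "\<And>y z. \<lbrakk>y \<in> F; z \<in> F; z \<noteq> y\<rbrakk> \<Longrightarrow> d y \<le> dist y z"
    by metis
  have "ball y (d y / 2) \<inter> ball z (d z / 2) = {}" if "y \<in> F" "z \<in> F" "y \<noteq> z" for y z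
  proof -
    have "w \<notin> ball z (d z / 2)" if "w \<in> ball y (d y / 2)" for w
      using that d(2)[of y z] d(2)[of z y] \<open>y \<in> F\<close> \<open>z \<in> F\<close> \<open>y \<noteq> z\<close> dist_triangle[of y z w]
      by (auto simp: dist_commute)
    then show ?thesis by blast
  qed
  then show ?thesis
    using that[of "\<lambda>y. ball y (d y / 2)"] d(1) by (auto simp: disjoint_family_on_def)
qed

text \<open>
  The sets \<open>B y\<close> separate the values at \<open>a\<close>, and \<open>U\<close> collects the points at which \<open>\<phi>\<close> still meets all of
  them. Over \<open>U\<close> the \<open>n\<close> values are distributed over \<open>n\<close> disjoint sets with none left empty, so
  each set receives exactly one; that value depends continuously on the point by lower
  semicontinuity again.
\<close>

lemma n_valued_map_local_selections:
  fixes \<phi> :: "'a::topological_space \<Rightarrow> 'b::metric_space set"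
  assumes \<phi>: "n_valued_map n (top_of_set S) (top_of_set T) \<phi>" and a: "a \<in> S"
  obtains U B s where "openin (top_of_set S) U" "a \<in> U"
    "disjoint_family_on B (\<phi> a)" "\<And>y. y \<in> \<phi> a \<Longrightarrow> open (B y)"
    "\<And>x. x \<in> U \<Longrightarrow> \<phi> x \<subseteq> (\<Union>y\<in>\<phi> a. B y)"
    "\<And>y. y \<in> \<phi> a \<Longrightarrow> continuous_on U (s y)"
    "\<And>x y. \<lbrakk>x \<in> U; y \<in> \<phi> a\<rbrakk> \<Longrightarrow> \<phi> x \<inter> B y = {s y x}"
proof -
  have fin: "finite (\<phi> a)" using n_valued_mapD[OF \<phi> a] by blast
  obtain B where B: "\<And>y. y \<in> \<phi> a \<Longrightarrow> open (B y) \<and> y \<in> B y" and dis: "disjoint_family_on B (\<phi> a)"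
    using finite_disjoint_open_neighbourhoods[OF fin] by metis
  \<comment> \<open>Intersecting with \<open>S\<close> gives the right set also when \<open>\<phi> a\<close> is empty, that is, when \<open>n = 0\<close>.\<close>
  define U where "U = S \<inter> (\<Inter>y\<in>\<phi> a. {x \<in> S. \<phi> x \<inter> B y \<noteq> {}})"
  have U_open: "openin (top_of_set S) U"
  proof (cases "\<phi> a = {}")
    case False
    have "openin (top_of_set S) (\<Inter>y\<in>\<phi> a. {x \<in> S. \<phi> x \<inter> B y \<noteq> {}})"
      using B n_valued_map_openin[OF \<phi>] False fin by (intro openin_INT2) auto
    then show ?thesis unfolding U_def by (intro openin_Int) simp_all
  qed (simp add: U_def)
  have "a \<in> U" using a B by (auto simp: U_def)
  define s where "s y x = (SOME z. z \<in> \<phi> x \<inter> B y)" for y x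
  have s: "s y x \<in> \<phi> x \<inter> B y" if "x \<in> U" "y \<in> \<phi> a" for x y
  proof -
    have "\<exists>z. z \<in> \<phi> x \<inter> B y" using that by (auto simp: U_def)
    then show ?thesis unfolding s_def by (rule someI_ex)
  qed
  have img: "(\<lambda>y. s y x) ` \<phi> a = \<phi> x" if x: "x \<in> U" for x
  proof -
    have xS: "x \<in> S" using x by (simp add: U_def)
    have "inj_on (\<lambda>y. s y x) (\<phi> a)"
      using s[OF x] dis by (force simp: inj_on_def disjoint_family_on_def)
    then have "card ((\<lambda>y. s y x) ` \<phi> a) = card (\<phi> x)"
      using n_valued_mapD(3)[OF \<phi>] a xS by (simp add: card_image)
    moreover have "(\<lambda>y. s y x) ` \<phi> a \<subseteq> \<phi> x" using s[OF x] by blast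
    ultimately show ?thesis
      using n_valued_mapD(2)[OF \<phi> xS] by (simp add: card_subset_eq)
  qed
  have sing: "\<phi> x \<inter> B y = {s y x}" if x: "x \<in> U" and y: "y \<in> \<phi> a" for x y
  proof -
    have "z = s y x" if z: "z \<in> \<phi> x" "z \<in> B y" for z
    proof -
      obtain y' where y': "y' \<in> \<phi> a" "z = s y' x" using img[OF x] z(1) by blast
      then have "z \<in> B y'" using s[OF x] by blast
      then have "y' = y" using dis y y'(1) z(2) by (auto simp: disjoint_family_on_def)
      then show ?thesis using y' by simp
    qed
    then show ?thesis using s[OF x y] by blast
  qed
  have cov: "\<phi> x \<subseteq> (\<Union>y\<in>\<phi> a. B y)" if "x \<in> U" for x
    using s[OF that] by (subst img[OF that, symmetric]) blast
  have cont: "continuous_on U (s y)" if y: "y \<in> \<phi> a" for y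
  proof (rule continuous_on_open_gen[where T=UNIV, THEN iffD2, rule_format])
    fix V :: "'b set" assume "openin (top_of_set UNIV) V"
    then have "open (B y \<inter> V)" using B[OF y] by (simp add: open_Int)
    then have "openin (top_of_set S) {x \<in> S. \<phi> x \<inter> (B y \<inter> V) \<noteq> {}}"
      by (rule n_valued_map_openin[OF \<phi>])
    then have "openin (top_of_set S) (U \<inter> {x \<in> S. \<phi> x \<inter> (B y \<inter> V) \<noteq> {}})"
      by (rule openin_Int[OF U_open])
    moreover have "\<phi> x \<inter> (B y \<inter> V) \<noteq> {} \<longleftrightarrow> s y x \<in> V" if "x \<in> U" for x
    proof -
      have "\<phi> x \<inter> (B y \<inter> V) = {s y x} \<inter> V" using sing[OF that y] by (simp add: Int_assoc[symmetric])
      then show ?thesis by simp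
    qed
    then have "U \<inter> {x \<in> S. \<phi> x \<inter> (B y \<inter> V) \<noteq> {}} = U \<inter> s y -` V"
      using openin_imp_subset[OF U_open] by auto
    ultimately have "openin (top_of_set S) (U \<inter> s y -` V)" by simp
    then show "openin (top_of_set U) (U \<inter> s y -` V)"
      by (meson Int_lower1 U_open openin_imp_subset openin_subset_trans)
  qed auto
  show thesis
  proof (rule that[of U B s])
    show "open (B y)" if "y \<in> \<phi> a" for y using B[OF that] ..
  qed (fact U_open \<open>a \<in> U\<close> dis cov cont sing)+
qed

text \<open>
  Over the neighbourhood given by the local selections, the graph falls apart into the graphs of these
  selections. Positivity of \<open>n\<close> makes the projection surjective.
\<close>

lemma n_valued_map_graph_covering_space:
  fixes \<phi> :: "'a::metric_space \<Rightarrow> 'b::metric_space set"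
  assumes \<phi>: "n_valued_map n (top_of_set S) (top_of_set T) \<phi>" and "n > 0"
  shows "covering_space (Sigma S \<phi>) fst S"
proof
  show "continuous_on (Sigma S \<phi>) fst" by (rule continuous_on_fst[OF continuous_on_id])
  show "fst ` Sigma S \<phi> = S"
  proof -
    have "\<phi> x \<noteq> {}" if "x \<in> S" for x
      using n_valued_mapD(3)[OF \<phi> that] \<open>n > 0\<close> by auto
    then show ?thesis by (simp add: fst_image_Sigma Collect_conj_eq) blast
  qed
  fix a assume a: "a \<in> S"
  from n_valued_map_local_selections[OF \<phi> a]
  obtain U B s where U: "openin (top_of_set S) U" "a \<in> U"
    and dis: "disjoint_family_on B (\<phi> a)" and B: "\<And>y. y \<in> \<phi> a \<Longrightarrow> open (B y)"
    and cov: "\<And>x. x \<in> U \<Longrightarrow> \<phi> x \<subseteq> (\<Union>y\<in>\<phi> a. B y)"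
    and cont: "\<And>y. y \<in> \<phi> a \<Longrightarrow> continuous_on U (s y)"
    and sing: "\<And>x y. \<lbrakk>x \<in> U; y \<in> \<phi> a\<rbrakk> \<Longrightarrow> \<phi> x \<inter> B y = {s y x}"
    by metis
  have US: "U \<subseteq> S" using U(1) openin_imp_subset by blast
  define sheet where "sheet y = Sigma S \<phi> \<inter> U \<times> B y" for y
  have open_sheet: "openin (top_of_set (Sigma S \<phi>)) (sheet y)" if y: "y \<in> \<phi> a" for y
  proof -
    obtain W where W: "open W" "U = S \<inter> W" using U(1) by (auto simp: openin_open)
    then have "sheet y = Sigma S \<phi> \<inter> W \<times> B y" by (auto simp: sheet_def)
    then show ?thesis using W(1) B[OF y] by (auto intro: open_Times)
  qed
  have Union_sheet: "\<Union> (sheet ` \<phi> a) = Sigma S \<phi> \<inter> fst -` U"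
    using cov by (fastforce simp: sheet_def)
  have disjnt_sheet: "pairwise disjnt (sheet ` \<phi> a)"
    using dis by (force simp: pairwise_def disjnt_def sheet_def disjoint_family_on_def)
  have homeo: "homeomorphism (sheet y) U fst (\<lambda>x. (x, s y x))" if y: "y \<in> \<phi> a" for y
  proof -
    have mem: "(x, z) \<in> sheet y \<longleftrightarrow> x \<in> U \<and> z = s y x" for x z
      using sing[of x y] y US by (auto simp: sheet_def)
    then have "sheet y = (\<lambda>x. (x, s y x)) ` U" by auto
    then show ?thesis
      unfolding homeomorphism_def
      by (auto simp: image_image intro!: continuous_intros cont y)
  qed
  show "\<exists>V. a \<in> V \<and> openin (top_of_set S) V \<and>
      (\<exists>v. \<Union> v = Sigma S \<phi> \<inter> fst -` V \<and> (\<forall>u\<in>v. openin (top_of_set (Sigma S \<phi>)) u) \<and>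
           pairwise disjnt v \<and> (\<forall>u\<in>v. \<exists>q. homeomorphism u V fst q))"
  proof (intro exI conjI)
    show "\<Union> (sheet ` \<phi> a) = Sigma S \<phi> \<inter> fst -` U" by (rule Union_sheet)
    show "\<forall>u\<in>sheet ` \<phi> a. openin (top_of_set (Sigma S \<phi>)) u" using open_sheet by simp
    show "\<forall>u\<in>sheet ` \<phi> a. \<exists>q. homeomorphism u U fst q"
      by (rule ballI, erule imageE, hypsubst) (rule exI, erule homeo)
  qed (rule U disjnt_sheet)+
qed

text \<open>
  A lift of the identity of \<open>S\<close> to the graph is the same thing as a continuous selection.
\<close>

lemma n_valued_map_selection:
  fixes \<phi> :: "'a::real_normed_vector \<Rightarrow> 'b::real_normed_vector set"
  assumes \<phi>: "n_valued_map n (top_of_set S) (top_of_set T) \<phi>"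
    and S: "simply_connected S" "locally path_connected S"
    and z: "z \<in> S" "y \<in> \<phi> z"
  obtains f where "continuous_on S f" "\<And>x. x \<in> S \<Longrightarrow> f x \<in> \<phi> x" "f z = y"
proof -
  have "n > 0" using n_valued_mapD[OF \<phi> z(1)] z(2) card_gt_0_iff by blast
  then have "covering_space (Sigma S \<phi>) fst S" by (rule n_valued_map_graph_covering_space[OF \<phi>])
  moreover have "(z, y) \<in> Sigma S \<phi>" using z by simp
  ultimately obtain g where g: "continuous_on S g" "g \<in> S \<rightarrow> Sigma S \<phi>" "g z = (z, y)"
      "\<And>x. x \<in> S \<Longrightarrow> fst (g x) = x"
    using covering_space_lift_strong[OF _ _ z(1) S, of "Sigma S \<phi>" fst S "(z, y)" "\<lambda>x. x"]
    by (auto simp: continuous_on_id)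
  show thesis
  proof
    show "continuous_on S (snd \<circ> g)" using g(1) by (auto intro!: continuous_intros simp: o_def)
    show "(snd \<circ> g) x \<in> \<phi> x" if "x \<in> S" for x
      using g(2,4) that by (fastforce simp: mem_Sigma_iff Pi_iff)
  qed (simp add: g)
qed

lemma n_valued_map_selections_agree:
  fixes \<phi> :: "'a::real_normed_vector \<Rightarrow> 'b::real_normed_vector set"
  assumes \<phi>: "n_valued_map n (top_of_set S) (top_of_set T) \<phi>" and S: "connected S"
    and f: "continuous_on S f" "\<And>x. x \<in> S \<Longrightarrow> f x \<in> \<phi> x"
    and g: "continuous_on S g" "\<And>x. x \<in> S \<Longrightarrow> g x \<in> \<phi> x"
    and "a \<in> S" "f a = g a" "x \<in> S"
  shows "f x = g x"
proof -
  have "n > 0" using n_valued_mapD[OF \<phi> \<open>a \<in> S\<close>] f(2)[OF \<open>a \<in> S\<close>] card_gt_0_iff by blast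
  then have "covering_space (Sigma S \<phi>) fst S" by (rule n_valued_map_graph_covering_space[OF \<phi>])
  then have "(x, f x) = (x, g x)"
    by (rule covering_space_lift_unique[where f = "\<lambda>x. x" and ?g1.0 = "\<lambda>x. (x, f x)"
          and ?g2.0 = "\<lambda>x. (x, g x)" and T = S and a = a])
      (use assms in \<open>auto intro!: continuous_intros\<close>)
  then show ?thesis by simp
qed

section \<open>The degree of the antipodal map\<close>

text \<open>
  All the linear isometries needed to compute the degree of the antipodal map (reflections, swaps of
  two coordinates, sign changes) have this shape.
\<close>

lemma continuous_map_nsphere_signed_permutation:
  assumes \<pi>: "\<pi> permutes {..p}" and c: "\<And>i. (c i)\<^sup>2 = (1::real)"
  shows "continuous_map (nsphere p) (nsphere p) (\<lambda>x i. c i * x (\<pi> i))"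
proof -
  have "continuous_map (nsphere p) (powertop_real UNIV) (\<lambda>x i. c i * x (\<pi> i))"
    unfolding continuous_map_componentwise_UNIV
    by (intro allI continuous_map_real_mult_left continuous_map_nsphere_projection)
  moreover have "(\<Sum>i\<le>p. (x (\<pi> i))\<^sup>2) = (\<Sum>i\<le>p. (x i)\<^sup>2)" for x :: "nat \<Rightarrow> real"
    using sum.permute[OF \<pi>, of "\<lambda>i. (x i)\<^sup>2"] by (simp add: o_def)
  moreover have "\<pi> i = i" if "i > p" for i
    using permutes_not_in[OF \<pi>] that by simp
  ultimately show ?thesis
    using c by (subst (2) nsphere) (auto simp: continuous_map_in_subtopology power_mult_distrib nsphere)
qed

text \<open>
  The degree is known for the reflection in coordinate \<open>0\<close>. Swapping coordinates \<open>0\<close> and \<open>j\<close>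
  conjugates that reflection to the one in coordinate \<open>j\<close>, and conjugation by an involution does not
  change the degree.
\<close>

lemma Brouwer_degree2_coordinate_reflection:
  assumes "j \<le> p"
  shows "Brouwer_degree2 p (\<lambda>x i. if i = j then - x i else x i) = -1"
proof -
  let ?r = "\<lambda>j x i. if i = j then - x i else x i :: real"
  let ?s = "\<lambda>x i. x (Transposition.transpose 0 j i) :: real"
  have s: "continuous_map (nsphere p) (nsphere p) ?s"
    using continuous_map_nsphere_signed_permutation[of "Transposition.transpose 0 j" p "\<lambda>i. 1"] assms
    by (simp add: permutes_swap_id)
  have r: "continuous_map (nsphere p) (nsphere p) (?r 0)"
    using continuous_map_nsphere_reflection by simp
  have "?s \<circ> ?s = id" by (simp add: fun_eq_iff)
  then have ss: "Brouwer_degree2 p ?s * Brouwer_degree2 p ?s = 1"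
    using Brouwer_degree2_compose[OF s s] by simp
  have "?r j = ?s \<circ> (?r 0 \<circ> ?s)"
    by (auto simp: fun_eq_iff Transposition.transpose_def)
  then have "Brouwer_degree2 p (?r j) = Brouwer_degree2 p ?s * (- 1 * Brouwer_degree2 p ?s)"
    using Brouwer_degree2_compose[OF continuous_map_compose[OF s r] s]
      Brouwer_degree2_compose[OF s r] by (simp add: Brouwer_degree2_reflection)
  then show ?thesis using ss by simp
qed

text \<open>
  The antipodal map is reached by changing the sign of one coordinate at a time; each of the \<open>p + 1\<close>
  steps contributes a factor \<open>-1\<close>.
\<close>

lemma Brouwer_degree2_antipodal:
  "Brouwer_degree2 p (\<lambda>x i. - x i) = (-1) ^ Suc p"
proof -
  let ?neg = "\<lambda>m x i. if i < m then - x i else x i :: real"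
  have cont: "continuous_map (nsphere p) (nsphere p) (\<lambda>x i. if P i then - x i else x i)" for P
    using continuous_map_nsphere_signed_permutation[OF permutes_id, of "\<lambda>i. if P i then -1 else 1" p]
    by (simp add: if_distrib if_distribR cong: if_cong)
  have "m \<le> Suc p \<Longrightarrow> Brouwer_degree2 p (?neg m) = (-1) ^ m" for m
  proof (induction m)
    case 0
    then show ?case using Brouwer_degree2_id by (simp add: id_def)
  next
    case (Suc m)
    have "?neg (Suc m) = (\<lambda>x i. if i = m then - x i else x i) \<circ> ?neg m"
      by (auto simp: fun_eq_iff)
    then have "Brouwer_degree2 p (?neg (Suc m)) = -1 * Brouwer_degree2 p (?neg m)"
      using Brouwer_degree2_compose[OF cont[of "\<lambda>i. i < m"] cont[of "\<lambda>i. i = m"]]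
        Brouwer_degree2_coordinate_reflection[of m p] Suc.prems by simp
    then show ?case using Suc by simp
  qed
  from this[of "Suc p"] have "Brouwer_degree2 p (?neg (Suc p)) = (-1) ^ Suc p" by simp
  \<comment> \<open>The two functions differ as functions on sequences, but coordinates beyond \<open>p\<close> vanish on the sphere.\<close>
  moreover have "homotopic_with (\<lambda>x. True) (nsphere p) (nsphere p) (?neg (Suc p)) (\<lambda>x i. - x i)"
    by (rule homotopic_with_equal[OF _ _ cont]) (auto simp: nsphere fun_eq_iff)
  ultimately show ?thesis by (simp only: Brouwer_degree2_homotopic)
qed

text \<open>
  Coordinates with respect to an enumerated orthonormal basis identify the two models of the sphere.
  Since these coordinates are linear, the identification carries the antipodal map of one model to that
  of the other; this is the reason for asking that \<open>g\<close> be odd.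
\<close>

lemma homeomorphic_maps_nsphere_sphere_odd:
  assumes "DIM('a::euclidean_space) = Suc p"
  obtains f :: "(nat \<Rightarrow> real) \<Rightarrow> 'a::euclidean_space" and g
  where "homeomorphic_maps (nsphere p) (top_of_set (sphere 0 1)) f g" "\<And>v. g (- v) = (\<lambda>i. - g v i)"
proof -
  obtain b where b: "bij_betw b {..p} (Basis :: 'a set)"
    using assms by (metis card_atMost finite_Basis finite_atMost finite_same_card_bij)
  define f where "f x = (\<Sum>i\<le>p. x i *\<^sub>R b i)" for x
  define g where "g v i = (if i \<le> p then v \<bullet> b i else 0)" for v i
  have bb: "b i \<bullet> b j = (if i = j then 1 else 0)" if "i \<le> p" "j \<le> p" for i j
  proof -
    have "b i \<in> Basis" "b j \<in> Basis" "b i = b j \<longleftrightarrow> i = j"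
      using b that by (auto simp: bij_betw_def inj_on_def)
    then show ?thesis by (simp add: inner_Basis)
  qed
  have fg: "f (g v) = v" for v
  proof -
    have "f (g v) = (\<Sum>i\<le>p. (v \<bullet> b i) *\<^sub>R b i)" by (simp add: f_def g_def)
    also have "\<dots> = (\<Sum>e\<in>Basis. (v \<bullet> e) *\<^sub>R e)"
      by (rule sum.reindex_bij_betw[OF b])
    finally show ?thesis by (simp add: euclidean_representation)
  qed
  have f_inner: "f x \<bullet> b j = x j" if "j \<le> p" for x j
    using that by (simp add: f_def inner_sum_left bb if_distrib cong: if_cong)
  have norm_f: "norm (f x) ^ 2 = (\<Sum>i\<le>p. (x i)\<^sup>2)" for x
  proof -
    have "norm (f x) ^ 2 = (\<Sum>i\<le>p. x i * (b i \<bullet> f x))"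
      unfolding power2_norm_eq_inner by (subst (1) f_def) (simp add: inner_sum_left)
    also have "\<dots> = (\<Sum>i\<le>p. (x i)\<^sup>2)"
      by (intro sum.cong) (simp_all add: inner_commute[of _ "f x"] f_inner power2_eq_square)
    finally show ?thesis .
  qed
  have sum_g: "(\<Sum>i\<le>p. (g v i)\<^sup>2) = 1" if "norm v = 1" for v
    using norm_f[of "g v"] that by (simp add: fg)
  have "continuous_map (nsphere p) euclidean (\<lambda>x. x i *\<^sub>R b i)" for i
  proof -
    have "continuous_map euclideanreal euclidean (\<lambda>r. r *\<^sub>R b i)"
      by (auto intro!: continuous_intros)
    from continuous_map_compose[OF continuous_map_nsphere_projection this]
    show ?thesis by (simp add: o_def)
  qed
  then have "continuous_map (nsphere p) euclidean f"
    unfolding f_def by (intro continuous_map_sum) auto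
  moreover have "norm (f x) = 1" if "x \<in> topspace (nsphere p)" for x
    using that norm_f[of x] power2_eq_imp_eq[of "norm (f x)" 1] by (simp add: nsphere)
  ultimately have cf: "continuous_map (nsphere p) (top_of_set (sphere 0 1)) f"
    by (auto simp: continuous_map_in_subtopology)
  have "continuous_on (sphere 0 1) (\<lambda>v. g v i)" for i
    by (cases "i \<le> p") (auto simp: g_def intro!: continuous_intros)
  then have cg: "continuous_map (top_of_set (sphere 0 1)) (nsphere p) g"
    unfolding nsphere continuous_map_in_subtopology continuous_map_componentwise_UNIV
    by (auto simp: sum_g) (simp add: g_def)
  have gf: "g (f x) = x" if "x \<in> topspace (nsphere p)" for x
    using that by (auto simp: g_def f_inner nsphere fun_eq_iff)
  show thesis
  proof
    show "homeomorphic_maps (nsphere p) (top_of_set (sphere 0 1)) f g"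
      using cf cg fg gf by (simp add: homeomorphic_maps_def)
    show "g (- v) = (\<lambda>i. - g v i)" for v
      by (simp add: g_def fun_eq_iff)
  qed
qed

lemma antipodal_not_homotopic_id_even_sphere:
  assumes "odd (DIM('a::euclidean_space))"
  shows "\<not> homotopic_with_canon (\<lambda>_. True) (sphere (0::'a::euclidean_space) 1) (sphere 0 1) uminus id"
proof
  assume hom: "homotopic_with_canon (\<lambda>_. True) (sphere (0::'a::euclidean_space) 1) (sphere 0 1) uminus id"
  obtain p where p: "DIM('a) = Suc p" using assms by (metis odd_pos gr0_implies_Suc)
  obtain f :: "(nat \<Rightarrow> real) \<Rightarrow> 'a" and g where
    fg: "homeomorphic_maps (nsphere p) (top_of_set (sphere 0 1)) f g"
    and odd: "\<And>v. g (- v) = (\<lambda>i. - g v i)"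
    using homeomorphic_maps_nsphere_sphere_odd[OF p] by metis
  have cf: "continuous_map (nsphere p) (top_of_set (sphere 0 1)) f"
    and cg: "continuous_map (top_of_set (sphere 0 1)) (nsphere p) g"
    and gf: "\<And>x. x \<in> topspace (nsphere p) \<Longrightarrow> g (f x) = x"
    using fg by (auto simp: homeomorphic_maps_def)
  have "homotopic_with (\<lambda>_. True) (nsphere p) (nsphere p) (g \<circ> (uminus \<circ> f)) (g \<circ> (id \<circ> f))"
    by (rule homotopic_with_compose_continuous_map_left
        [OF homotopic_with_compose_continuous_map_right[OF hom cf] cg]) auto
  then have "homotopic_with (\<lambda>_. True) (nsphere p) (nsphere p) (\<lambda>x i. - x i) id"
    by (rule homotopic_with_eq) (auto simp: odd gf)
  then have "Brouwer_degree2 p (\<lambda>x i. - x i) = Brouwer_degree2 p id"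
    by (rule Brouwer_degree2_homotopic)
  then have "(-1) ^ Suc p = (1::int)" by (simp only: Brouwer_degree2_antipodal Brouwer_degree2_id)
  then show False using assms p by (simp add: uminus_power_if)
qed

section \<open>Self-maps of even-dimensional spheres\<close>

text \<open>
  The segment from \<open>f x\<close> to \<open>g x\<close> avoids the origin, so the straight-line homotopy can be projected
  radially to the sphere.
\<close>

lemma homotopic_non_antipodal_maps_to_sphere:
  fixes f g :: "'a::topological_space \<Rightarrow> 'b::real_normed_vector"
  assumes f: "continuous_on S f" "f \<in> S \<rightarrow> sphere 0 1"
    and g: "continuous_on S g" "g \<in> S \<rightarrow> sphere 0 1"
    and ne: "\<And>x. x \<in> S \<Longrightarrow> f x \<noteq> - g x"
  shows "homotopic_with_canon (\<lambda>_. True) S (sphere 0 1) f g"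
proof -
  let ?\<rho> = "\<lambda>v. v /\<^sub>R norm v"
  have "0 \<notin> closed_segment (f x) (g x)" if x: "x \<in> S" for x
  proof
    assume "0 \<in> closed_segment (f x) (g x)"
    then obtain t where t: "0 \<le> t" "t \<le> 1" "(1 - t) *\<^sub>R f x + t *\<^sub>R g x = 0"
      by (auto simp: closed_segment_def)
    have n: "norm (f x) = 1" "norm (g x) = 1" using f(2) g(2) x by (auto simp: Pi_iff)
    have eq: "(1 - t) *\<^sub>R f x = t *\<^sub>R (- g x)" using t(3) by (simp add: add_eq_0_iff2)
    \<comment> \<open>The two ends have equal norm, so the origin can only be the midpoint.\<close>
    then have "norm ((1 - t) *\<^sub>R f x) = norm (t *\<^sub>R (- g x))" by simp
    then have "1 - t = t" and "t \<noteq> 0" using t(1,2) n by auto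
    then have "f x = - g x" using eq by (metis real_vector.scale_left_imp_eq)
    then show False using ne[OF x] by simp
  qed
  then have "homotopic_with_canon (\<lambda>_. True) S (- {0}) f g"
    by (intro homotopic_with_linear f g) blast
  then have "homotopic_with_canon (\<lambda>_. True) S (sphere 0 1) (?\<rho> \<circ> f) (?\<rho> \<circ> g)"
    by (rule homotopic_with_compose_continuous_left) (auto intro!: continuous_intros)
  then show ?thesis
    by (rule homotopic_with_eq) (use f(2) g(2) in \<open>auto simp: Pi_iff\<close>)
qed

text \<open>
  Otherwise \<open>uminus \<simeq> f \<simeq> (\<lambda>x. - g x) \<simeq> id\<close>, each pair of neighbours being nowhere antipodal.
\<close>

lemma even_sphere_selfmaps_coincidence_or_fixpoint:
  fixes f g :: "'a::euclidean_space \<Rightarrow> 'a"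
  assumes dim: "odd (DIM('a))"
    and f: "continuous_on (sphere 0 1) f" "f \<in> sphere 0 1 \<rightarrow> sphere 0 1"
    and g: "continuous_on (sphere 0 1) g" "g \<in> sphere 0 1 \<rightarrow> sphere 0 1"
  shows "\<exists>x\<in>sphere 0 1. f x = x \<or> g x = x \<or> f x = g x"
proof (rule ccontr)
  assume "\<not> ?thesis"
  then have ne: "x \<noteq> f x" "g x \<noteq> x" "f x \<noteq> g x" if "x \<in> sphere 0 1" for x
    using that by metis+
  let ?S = "sphere (0::'a) 1"
  have "homotopic_with_canon (\<lambda>_. True) ?S ?S uminus f"
    by (rule homotopic_non_antipodal_maps_to_sphere) (use f ne in \<open>auto intro!: continuous_intros\<close>)
  moreover have "homotopic_with_canon (\<lambda>_. True) ?S ?S f (\<lambda>x. - g x)"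
    by (rule homotopic_non_antipodal_maps_to_sphere) (use f g ne in \<open>auto intro!: continuous_intros\<close>)
  moreover have "homotopic_with_canon (\<lambda>_. True) ?S ?S (\<lambda>x. - g x) id"
    by (rule homotopic_non_antipodal_maps_to_sphere) (use g ne in \<open>auto intro!: continuous_intros\<close>)
  ultimately show False
    using antipodal_not_homotopic_id_even_sphere[OF dim] homotopic_with_trans by blast
qed

theorem proposition2:
  fixes n k :: nat
  assumes "n \<ge> 2" and "k \<ge> 1"
    and "DIM('a::euclidean_space) = 2 * k + 1"
  shows "n_valued_fixed_point_property n (top_of_set (sphere (0::'a) 1))"
  unfolding n_valued_fixed_point_property_def
proof (intro allI impI)
  let ?S = "sphere (0::'a) 1"
  fix \<phi> assume \<phi>: "n_valued_map n (top_of_set ?S) (top_of_set ?S) \<phi>"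
  have sc: "simply_connected ?S" and lpc: "locally path_connected ?S"
    using assms by (auto simp: simply_connected_sphere locally_path_connected_sphere)
  obtain z where z: "z \<in> ?S" using vector_choose_size[of 1] by (metis mem_sphere_0 zero_le_one)
  then have "\<not> is_singleton (\<phi> z)" "\<phi> z \<noteq> {}"
    using n_valued_mapD(3)[OF \<phi> z] \<open>n \<ge> 2\<close> by (auto simp: is_singleton_altdef)
  then obtain y y' where y: "y \<in> \<phi> z" "y' \<in> \<phi> z" "y \<noteq> y'"
    by (metis is_singletonI')
  obtain f where f: "continuous_on ?S f" "\<And>x. x \<in> ?S \<Longrightarrow> f x \<in> \<phi> x" "f z = y"
    using n_valued_map_selection[OF \<phi> sc lpc z y(1)] by metis
  obtain g where g: "continuous_on ?S g" "\<And>x. x \<in> ?S \<Longrightarrow> g x \<in> \<phi> x" "g z = y'"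
    using n_valued_map_selection[OF \<phi> sc lpc z y(2)] by metis
  have ne: "f x \<noteq> g x" if "x \<in> ?S" for x
    using n_valued_map_selections_agree[OF \<phi> simply_connected_imp_connected[OF sc] f(1,2) g(1,2) that _ z]
      y(3) f(3) g(3) by blast
  have "f \<in> ?S \<rightarrow> ?S" "g \<in> ?S \<rightarrow> ?S"
    using f(2) g(2) n_valued_mapD(1)[OF \<phi>] by blast+
  then obtain x where "x \<in> ?S" "f x = x \<or> g x = x"
    using even_sphere_selfmaps_coincidence_or_fixpoint[of f g] f(1) g(1) ne assms(3) by force
  then show "\<exists>x. multi_fixed_point (top_of_set ?S) \<phi> x"
    using f(2) g(2) unfolding multi_fixed_point_def by (metis topspace_euclidean_subtopology)
qed

end
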